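(* Let $\mathbf{k}$ be a commutative unitary ring and $\lambda\in\mathbf{k}$. Let $\mathcal{F}$ be the set of planar rooted forests, let $\diamond$ be the bilinear product (depending on $\lambda$) on the free $\mathbf{k}$-module $\mathbf{k}\,\mathcal{F}$ defined in the context, and let $P_{\mathcal{F}}:\mathbf{k}\,\mathcal{F}\to\mathbf{k}\,\mathcal{F}$ be the $\mathbf{k}$-linear operator determined by $P_{\mathcal F}(F)=\lfloor F\rfloor$ for $F\in\mathcal{F}$ (grafting). Then: (a) The pair $(\mathbf{k}\,\mathcal{F},\diamond)$ is a unitary associative algebra. (b) The triple $(\mathbf{k}\,\mathcal{F},\diamond,P_{\mathcal{F}})$ is a unitary Rota--Baxter algebra of weight $\lambda$.
   Context: Rota--Baxter algebra of weight $\lambda$: an associative $\mathbf{k}$-algebra $R$ with a $\mathbf{k}$-linear map $P:R\to R$ such that $P(x)P(y)=P\big(P(x)y+xP(y)+\lambda xy\big)$ for all $x,y\in R$; it is unitary if $R$ has an identity element. Forests: $\mathcal{T}$ is the set of planar rooted trees; $\bullet$ is the tree with a single vertex. $\mathcal{F}$ is the free semigroup generated by $\mathcal{T}$, with product (concatenation) denoted $\sqcup$; its elements $T_1\sqcup\cdots\sqcup T_b$ ($b\ge 1$, $T_i\in\mathcal{T}$) are called planar rooted forests. The grafting $\lfloor T_1\sqcup\cdots\sqcup T_b\rfloor$ is the tree obtained by adding a new root together with an edge from the new root to the root of each $T_i$ (keeping the order). Every tree is either $\bullet$ or of the form $\lfloor \overline{F}\rfloor$ for a unique forest $\overline{F}$.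 The depth of a tree is the length of the longest path from its root to a leaf; the depth $\mathrm{d}(F)$ of a forest is the maximal depth of its trees, so $\mathrm{d}(\lfloor F\rfloor)=\mathrm{d}(F)+1$. The product $\sqcup$ and the grafting $\lfloor\ \rfloor$ are extended (bi)linearly to $\mathbf{k}\,\mathcal{F}$, the free $\mathbf{k}$-module on $\mathcal F$. Product $\diamond$: it is defined on $\mathcal{F}\times\mathcal{F}$ with values in $\mathbf{k}\,\mathcal{F}$ by induction on $\mathrm{d}(F)+\mathrm{d}(F')$ and extended bilinearly. For trees $F,F'$: $F\diamond\bullet=F$, $\bullet\diamond F'=F'$, and if $F=\lfloor\overline{F}\rfloor$, $F'=\lfloor\overline{F}'\rfloor$ then $$F\diamond F'=\lfloor\lfloor\overline{F}\rfloor\diamond\overline{F}'\rfloor+\lfloor\overline{F}\diamond\lfloor\overline{F}'\rfloor\rfloor+\lambda\lfloor\overline{F}\diamond\overline{F}'\rfloor .$$ For forests $F=T_1\sqcup\cdots\sqcup T_b$ and $F'=T'_1\sqcup\cdots\sqcup T'_{b'}$ (with $T_i,T'_j$ trees), $$F\diamond F'=T_1\sqcup\cdots\sqcup T_{b-1}\sqcup(T_b\diamond T'_1)\sqcup T'_2\sqcup\cdots\sqcup T'_{b'}.$$ In particular $\bullet^{\sqcup m}\diamond\bullet^{\sqcup n}=\bullet^{\sqcup(m+n-1)}$. *)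

theory Defs
  imports "HOL-Library.Poly_Mapping"
begin

text \<open>A forest is a nonempty list of planar rooted trees, so \<open>pforest\<close> with \<open>forest_append\<close>
  is the free semigroup on the trees; \<open>FSingle\<close> is the inclusion of the trees, and
  \<open>Graft\<close> is the grafting operation.\<close>

datatype ptree = Bullet | Graft pforest
  and pforest = FSingle ptree | FCons ptree pforest

primrec forest_append :: "pforest \<Rightarrow> pforest \<Rightarrow> pforest" (infixr "\<squnion>\<^sub>F" 65) where
  "FSingle t \<squnion>\<^sub>F G = FCons t G"
| "FCons t F \<squnion>\<^sub>F G = FCons t (F \<squnion>\<^sub>F G)"

primrec tree_depth :: "ptree \<Rightarrow> nat" and forest_depth :: "pforest \<Rightarrow> nat" where
  "tree_depth Bullet = 0"
| "tree_depth (Graft F) = Suc (forest_depth F)"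
| "forest_depth (FSingle t) = tree_depth t"
| "forest_depth (FCons t F) = max (tree_depth t) (forest_depth F)"

text \<open>The free module on a set of generators \<open>'b\<close> is \<open>'b \<Rightarrow>\<^sub>0 'k\<close>, with basis vectors
  \<open>basis b\<close>. The sort \<open>{comm_ring, comm_monoid_mult}\<close> is that of commutative unitary
  rings without the axiom \<open>0 \<noteq> 1\<close> of \<open>comm_ring_1\<close>, so that the zero ring is allowed.\<close>

definition fscale :: "'k::{comm_ring, comm_monoid_mult} \<Rightarrow> ('b \<Rightarrow>\<^sub>0 'k) \<Rightarrow> ('b \<Rightarrow>\<^sub>0 'k)" where
  "fscale c x = Poly_Mapping.map (\<lambda>a. c * a) x"

definition basis :: "'b \<Rightarrow> ('b \<Rightarrow>\<^sub>0 'k::{comm_ring, comm_monoid_mult})" where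
  "basis b = Poly_Mapping.single b 1"

definition lin_ext ::
  "('b \<Rightarrow> ('c \<Rightarrow>\<^sub>0 'k)) \<Rightarrow> ('b \<Rightarrow>\<^sub>0 'k::{comm_ring, comm_monoid_mult}) \<Rightarrow> ('c \<Rightarrow>\<^sub>0 'k)" where
  "lin_ext f x = (\<Sum>b\<in>Poly_Mapping.keys x. fscale (Poly_Mapping.lookup x b) (f b))"

definition bilin_ext ::
  "('b \<Rightarrow> 'c \<Rightarrow> ('d \<Rightarrow>\<^sub>0 'k)) \<Rightarrow> ('b \<Rightarrow>\<^sub>0 'k::{comm_ring, comm_monoid_mult})
    \<Rightarrow> ('c \<Rightarrow>\<^sub>0 'k) \<Rightarrow> ('d \<Rightarrow>\<^sub>0 'k)" where
  "bilin_ext f x y = lin_ext (\<lambda>b. lin_ext (f b) y) x"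

definition concat_lin ::
  "(pforest \<Rightarrow>\<^sub>0 'k::{comm_ring, comm_monoid_mult}) \<Rightarrow> (pforest \<Rightarrow>\<^sub>0 'k) \<Rightarrow> (pforest \<Rightarrow>\<^sub>0 'k)" where
  "concat_lin = bilin_ext (\<lambda>F G. basis (F \<squnion>\<^sub>F G))"

definition graft_lin ::
  "(pforest \<Rightarrow>\<^sub>0 'k::{comm_ring, comm_monoid_mult}) \<Rightarrow> (pforest \<Rightarrow>\<^sub>0 'k)" where
  "graft_lin = lin_ext (\<lambda>F. basis (FSingle (Graft F)))"

text \<open>The product on basis elements. The clauses for forests peel off the trees
  \<open>T\<^sub>1, \<dots>, T\<^sub>b\<^sub>-\<^sub>1\<close> of the left factor and \<open>T'\<^sub>2 \<squnion> \<dots>\<close> of the right factor, leaving the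
  product of the adjacent trees \<open>T\<^sub>b\<close> and \<open>T'\<^sub>1\<close>.\<close>

function (sequential)
  tree_diamond :: "'k::{comm_ring, comm_monoid_mult} \<Rightarrow> ptree \<Rightarrow> ptree \<Rightarrow> (pforest \<Rightarrow>\<^sub>0 'k)" and
  forest_diamond :: "'k \<Rightarrow> pforest \<Rightarrow> pforest \<Rightarrow> (pforest \<Rightarrow>\<^sub>0 'k)" where
  "tree_diamond lam t Bullet = basis (FSingle t)"
| "tree_diamond lam Bullet t' = basis (FSingle t')"
| "tree_diamond lam (Graft F) (Graft F') =
     graft_lin (forest_diamond lam (FSingle (Graft F)) F')
     + graft_lin (forest_diamond lam F (FSingle (Graft F')))
     + fscale lam (graft_lin (forest_diamond lam F F'))"
| "forest_diamond lam (FSingle t) (FSingle t') = tree_diamond lam t t'"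
| "forest_diamond lam (FSingle t) (FCons t' F') = concat_lin (tree_diamond lam t t') (basis F')"
| "forest_diamond lam (FCons t F) F' = concat_lin (basis (FSingle t)) (forest_diamond lam F F')"
  by pat_completeness auto
termination
  by (relation "measures
       [case_sum (\<lambda>(_, t, t'). tree_depth t + tree_depth t')
                 (\<lambda>(_, F, F'). forest_depth F + forest_depth F'),
        case_sum (\<lambda>_. 0) (\<lambda>(_, F, F'). size F)]") auto

definition diamond ::
  "'k::{comm_ring, comm_monoid_mult} \<Rightarrow> (pforest \<Rightarrow>\<^sub>0 'k) \<Rightarrow> (pforest \<Rightarrow>\<^sub>0 'k) \<Rightarrow> (pforest \<Rightarrow>\<^sub>0 'k)" where
  "diamond lam = bilin_ext (forest_diamond lam)"

text \<open>The module axioms are those of the locale \<open>module\<close>, which is not used because it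
  needs the sort \<open>comm_ring_1\<close>.\<close>

locale associative_algebra =
  fixes scale :: "'k::{comm_ring, comm_monoid_mult} \<Rightarrow> 'a::ab_group_add \<Rightarrow> 'a"
    and mult :: "'a \<Rightarrow> 'a \<Rightarrow> 'a"
  assumes scale_right_distrib: "scale a (x + y) = scale a x + scale a y"
    and scale_left_distrib: "scale (a + b) x = scale a x + scale b x"
    and scale_scale: "scale a (scale b x) = scale (a * b) x"
    and scale_one: "scale 1 x = x"
    and mult_add_left: "mult (x + y) z = mult x z + mult y z"
    and mult_add_right: "mult x (y + z) = mult x y + mult x z"
    and mult_scale_left: "mult (scale a x) y = scale a (mult x y)"
    and mult_scale_right: "mult x (scale a y) = scale a (mult x y)"
    and mult_assoc: "mult (mult x y) z = mult x (mult y z)"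

locale unitary_associative_algebra = associative_algebra +
  assumes ex_identity: "\<exists>e. \<forall>x. mult e x = x \<and> mult x e = x"

locale rota_baxter_algebra = associative_algebra scale mult
  for scale :: "'k::{comm_ring, comm_monoid_mult} \<Rightarrow> 'a::ab_group_add \<Rightarrow> 'a"
    and mult :: "'a \<Rightarrow> 'a \<Rightarrow> 'a" +
  fixes weight :: 'k and P :: "'a \<Rightarrow> 'a"
  assumes P_add: "P (x + y) = P x + P y"
    and P_scale: "P (scale a x) = scale a (P x)"
    and rota_baxter:
      "mult (P x) (P y) = P (mult (P x) y + mult x (P y) + scale weight (mult x y))"

locale unitary_rota_baxter_algebra =
  rota_baxter_algebra scale mult weight P + unitary_associative_algebra scale mult
  for scale :: "'k::{comm_ring, comm_monoid_mult} \<Rightarrow> 'a::ab_group_add \<Rightarrow> 'a"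
    and mult :: "'a \<Rightarrow> 'a \<Rightarrow> 'a" and weight :: 'k and P :: "'a \<Rightarrow> 'a"

end

theory Submission imports Defs begin

text \<open>The product \<open>\<diamond>\<close> obeys three rules on all of the free module, each of them extended
  linearly from forests, where the recursion yields it: \<open>\<diamond>\<close> is a map of left and of right modules for concatenation
  (\<open>diamond_concat_left\<close>, \<open>diamond_concat_right\<close>), the one-vertex tree is a two-sided unit
  (\<open>diamond_unit_left\<close>, \<open>diamond_unit_right\<close>), and grafting satisfies the Rota--Baxter identity
  (\<open>diamond_graft_graft\<close>).

  Associativity needs to be checked on forests only, by induction on the total size of the three
  factors. If one of them has more than one tree, then the module rules pull the surplus trees out of
  both bracketings: what remains is an associator with fewer trees, or, if the middle factor is
  the one that splits, the two bracketings already agree. If all three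
  are trees and one of them is the one-vertex tree, the unit rules apply. Otherwise all three
  are grafted, and expanding either bracketing by the Rota--Baxter identity gives the grafting of the
  same seven terms, up to the bracketing of products in which at least one factor has lost its
  root (\<open>associator_of_grafts\<close>); these are covered by the induction hypothesis.\<close>

section \<open>Linear extension\<close>

lemma lookup_fscale: "Poly_Mapping.lookup (fscale c x) b = c * Poly_Mapping.lookup x b"
  by (simp add: fscale_def map.rep_eq when_def)

lemma fscale_add_right: "fscale c (x + y) = fscale c x + fscale c y"
  by (rule poly_mapping_eqI) (simp add: lookup_fscale lookup_add distrib_left)

lemma fscale_add_left: "fscale (a + b) x = fscale a x + fscale b x"
  by (rule poly_mapping_eqI) (simp add: lookup_fscale lookup_add distrib_right)

lemma fscale_fscale: "fscale a (fscale b x) = fscale (a * b) x"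
  by (rule poly_mapping_eqI) (simp add: lookup_fscale mult.assoc)

lemma fscale_one: "fscale 1 x = x"
  by (rule poly_mapping_eqI) (simp add: lookup_fscale)

lemma fscale_zero_left: "fscale 0 x = 0"
  by (rule poly_mapping_eqI) (simp add: lookup_fscale)

lemma fscale_zero_right: "fscale c 0 = 0"
  by (rule poly_mapping_eqI) (simp add: lookup_fscale)

lemma fscale_left_commute: "fscale a (fscale b x) = fscale b (fscale a x)"
  by (simp add: fscale_fscale mult.commute)

lemma fscale_sum: "fscale c (sum f A) = (\<Sum>b\<in>A. fscale c (f b))"
  by (induction A rule: infinite_finite_induct)
    (simp_all add: fscale_zero_right fscale_add_right)

lemma lin_ext_superset:
  assumes "finite A" "Poly_Mapping.keys x \<subseteq> A"
  shows "lin_ext f x = (\<Sum>b\<in>A. fscale (Poly_Mapping.lookup x b) (f b))"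
  unfolding lin_ext_def using assms
  by (intro sum.mono_neutral_left) (auto simp: in_keys_iff fscale_zero_left)

lemma lin_ext_add: "lin_ext f (x + y) = lin_ext f x + lin_ext f y"
proof -
  let ?A = "Poly_Mapping.keys x \<union> Poly_Mapping.keys y"
  have "lin_ext f z = (\<Sum>b\<in>?A. fscale (Poly_Mapping.lookup z b) (f b))"
    if "Poly_Mapping.keys z \<subseteq> ?A" for z
    using that by (intro lin_ext_superset) auto
  then show ?thesis
    by (simp add: keys_add lookup_add fscale_add_left sum.distrib)
qed

lemma lin_ext_fscale: "lin_ext f (fscale c x) = fscale c (lin_ext f x)"
proof -
  have "Poly_Mapping.keys (fscale c x) \<subseteq> Poly_Mapping.keys x"
    by (auto simp: in_keys_iff lookup_fscale)
  then have "lin_ext f (fscale c x)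
      = (\<Sum>b\<in>Poly_Mapping.keys x. fscale (c * Poly_Mapping.lookup x b) (f b))"
    by (simp add: lin_ext_superset[of "Poly_Mapping.keys x"] lookup_fscale)
  then show ?thesis
    by (simp add: lin_ext_def fscale_sum fscale_fscale)
qed

lemma lin_ext_basis: "lin_ext f (basis b) = f b"
proof -
  \<comment> \<open>Over the zero ring \<open>basis b\<close> has no keys, so the sum is taken over a set known to contain \<open>b\<close>.\<close>
  have "lin_ext f (basis b)
      = (\<Sum>b'\<in>{b}. fscale (Poly_Mapping.lookup (basis b) b') (f b'))"
    by (rule lin_ext_superset) (auto simp: basis_def in_keys_iff lookup_single when_def)
  then show ?thesis by (simp add: basis_def lookup_single fscale_one)
qed

lemma lin_ext_fun_add: "lin_ext (\<lambda>b. f b + g b) x = lin_ext f x + lin_ext g x"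
  by (simp add: lin_ext_def fscale_add_right sum.distrib)

lemma lin_ext_fun_fscale: "lin_ext (\<lambda>b. fscale c (f b)) x = fscale c (lin_ext f x)"
  by (simp add: lin_ext_def fscale_sum fscale_left_commute[of c])

text \<open>This rule reduces every multilinear identity below to the case of basis vectors.\<close>

lemma free_module_induct [case_names basis add scale]:
  fixes x :: "'b \<Rightarrow>\<^sub>0 'k::{comm_ring, comm_monoid_mult}"
  assumes "\<And>b. Q (basis b)"
    and add: "\<And>x y. Q x \<Longrightarrow> Q y \<Longrightarrow> Q (x + y)"
    and scale: "\<And>c x. Q x \<Longrightarrow> Q (fscale c x)"
  shows "Q x"
proof -
  have zero: "Q 0"
    using scale[OF assms(1), of 0] by (simp add: fscale_zero_left)
  have "Q (\<Sum>b\<in>A. fscale (Poly_Mapping.lookup x b) (basis b))" if "finite A" for A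
    using that by (induction rule: finite_induct) (simp_all add: zero assms)
  moreover have "(\<Sum>b\<in>Poly_Mapping.keys x. fscale (Poly_Mapping.lookup x b) (basis b)) = x"
    by (rule poly_mapping_eqI)
      (auto simp: lookup_sum lookup_fscale basis_def lookup_single when_def in_keys_iff
        if_distrib cong: if_cong)
  ultimately show ?thesis by (metis finite_keys)
qed

lemma bilin_ext_add_left: "bilin_ext f (x + y) z = bilin_ext f x z + bilin_ext f y z"
  by (simp add: bilin_ext_def lin_ext_add)

lemma bilin_ext_add_right: "bilin_ext f x (y + z) = bilin_ext f x y + bilin_ext f x z"
  by (simp add: bilin_ext_def lin_ext_add lin_ext_fun_add)

lemma bilin_ext_fscale_left: "bilin_ext f (fscale c x) y = fscale c (bilin_ext f x y)"
  by (simp add: bilin_ext_def lin_ext_fscale)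

lemma bilin_ext_fscale_right: "bilin_ext f x (fscale c y) = fscale c (bilin_ext f x y)"
  by (simp add: bilin_ext_def lin_ext_fscale lin_ext_fun_fscale)

lemma bilin_ext_basis: "bilin_ext f (basis b) (basis c) = f b c"
  by (simp add: bilin_ext_def lin_ext_basis)

lemma graft_lin_linear:
  "graft_lin (x + y) = graft_lin x + graft_lin y"
  "graft_lin (fscale c x) = fscale c (graft_lin x)"
  by (simp_all add: graft_lin_def lin_ext_add lin_ext_fscale)

lemma concat_lin_bilinear:
  "concat_lin (x + y) z = concat_lin x z + concat_lin y z"
  "concat_lin x (y + z) = concat_lin x y + concat_lin x z"
  "concat_lin (fscale c x) y = fscale c (concat_lin x y)"
  "concat_lin x (fscale c y) = fscale c (concat_lin x y)"
  by (simp_all add: concat_lin_def bilin_ext_add_left bilin_ext_add_right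
      bilin_ext_fscale_left bilin_ext_fscale_right)

lemma diamond_bilinear:
  "diamond lam (x + y) z = diamond lam x z + diamond lam y z"
  "diamond lam x (y + z) = diamond lam x y + diamond lam x z"
  "diamond lam (fscale c x) y = fscale c (diamond lam x y)"
  "diamond lam x (fscale c y) = fscale c (diamond lam x y)"
  by (simp_all add: diamond_def bilin_ext_add_left bilin_ext_add_right
      bilin_ext_fscale_left bilin_ext_fscale_right)

lemma graft_lin_basis: "graft_lin (basis F) = basis (FSingle (Graft F))"
  by (simp add: graft_lin_def lin_ext_basis)

lemma concat_lin_basis: "concat_lin (basis F) (basis G) = basis (F \<squnion>\<^sub>F G)"
  by (simp add: concat_lin_def bilin_ext_basis)

lemma diamond_basis: "diamond lam (basis F) (basis G) = forest_diamond lam F G"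
  by (simp add: diamond_def bilin_ext_basis)

section \<open>Concatenation and the product\<close>

text \<open>Induction along the list of trees of a forest, without descending into the trees as the
  mutual induction rule of the datatypes does.\<close>

lemma pforest_list_induct [case_names FSingle FCons]:
  assumes "\<And>t. Q (FSingle t)" and "\<And>t F. Q F \<Longrightarrow> Q (FCons t F)"
  shows "Q F"
  by (rule pforest.induct[of "\<lambda>_. True"]) (simp_all add: assms)

lemma forest_append_assoc: "(F \<squnion>\<^sub>F G) \<squnion>\<^sub>F H = F \<squnion>\<^sub>F (G \<squnion>\<^sub>F H)"
  by (induction F rule: pforest_list_induct) simp_all

lemma concat_lin_assoc: "concat_lin (concat_lin x y) z = concat_lin x (concat_lin y z)"
proof (induction x rule: free_module_induct)
  case (basis F)
  show ?case
  proof (induction y rule: free_module_induct)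
    case (basis G)
    show ?case
      by (induction z rule: free_module_induct)
        (simp_all add: concat_lin_basis forest_append_assoc concat_lin_bilinear)
  qed (simp_all add: concat_lin_bilinear)
qed (simp_all add: concat_lin_bilinear)

lemma forest_diamond_append_left:
  "forest_diamond lam (F \<squnion>\<^sub>F G) H = concat_lin (basis F) (forest_diamond lam G H)"
proof (induction F rule: pforest_list_induct)
  case (FCons t F)
  then show ?case
    by (simp flip: concat_lin_assoc add: concat_lin_basis)
qed simp

lemma forest_diamond_append_right:
  "forest_diamond lam F (G \<squnion>\<^sub>F H) = concat_lin (forest_diamond lam F G) (basis H)"
proof (induction F rule: pforest_list_induct)
  case (FSingle t)
  show ?case
    by (cases G) (simp_all add: concat_lin_assoc concat_lin_basis)
next
  case (FCons t F)
  then show ?case by (simp add: concat_lin_assoc)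
qed

lemma diamond_concat_left:
  "diamond lam (concat_lin x y) z = concat_lin x (diamond lam y z)"
proof (induction x rule: free_module_induct)
  case (basis F)
  show ?case
  proof (induction y rule: free_module_induct)
    case (basis G)
    show ?case
      by (induction z rule: free_module_induct)
        (simp_all add: concat_lin_basis diamond_basis forest_diamond_append_left
          concat_lin_bilinear diamond_bilinear)
  qed (simp_all add: concat_lin_bilinear diamond_bilinear)
qed (simp_all add: concat_lin_bilinear diamond_bilinear)

lemma diamond_concat_right:
  "diamond lam x (concat_lin y z) = concat_lin (diamond lam x y) z"
proof (induction x rule: free_module_induct)
  case (basis F)
  show ?case
  proof (induction y rule: free_module_induct)
    case (basis G)
    show ?case
      by (induction z rule: free_module_induct)
        (simp_all add: concat_lin_basis diamond_basis forest_diamond_append_right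
          concat_lin_bilinear diamond_bilinear)
  qed (simp_all add: concat_lin_bilinear diamond_bilinear)
qed (simp_all add: concat_lin_bilinear diamond_bilinear)

section \<open>Unit and Rota--Baxter identity\<close>

lemma tree_diamond_Bullet_left: "tree_diamond lam Bullet t = basis (FSingle t)"
  by (cases t) simp_all

lemma diamond_unit_left: "diamond lam (basis (FSingle Bullet)) x = x"
proof (induction x rule: free_module_induct)
  case (basis F)
  show ?case
    by (cases F) (simp_all add: diamond_basis tree_diamond_Bullet_left concat_lin_basis)
qed (simp_all add: diamond_bilinear)

lemma diamond_unit_right: "diamond lam x (basis (FSingle Bullet)) = x"
proof (induction x rule: free_module_induct)
  case (basis F)
  show ?case
    by (induction F rule: pforest_list_induct) (simp_all add: diamond_basis concat_lin_basis)
qed (simp_all add: diamond_bilinear)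

lemma diamond_graft_graft:
  "diamond lam (graft_lin x) (graft_lin y)
    = graft_lin (diamond lam (graft_lin x) y + diamond lam x (graft_lin y)
        + fscale lam (diamond lam x y))"
proof (induction x rule: free_module_induct)
  case (basis F)
  show ?case
    by (induction y rule: free_module_induct)
      (simp_all add: graft_lin_basis diamond_basis graft_lin_linear diamond_bilinear
        fscale_add_right fscale_left_commute[of lam] ac_simps)
qed (simp_all add: graft_lin_linear diamond_bilinear fscale_add_right
    fscale_left_commute[of lam] ac_simps)

section \<open>Associativity\<close>

text \<open>With \<open>u = P x \<diamond> y + x \<diamond> P y + \<lambda> (x \<diamond> y)\<close> one has \<open>P x \<diamond> P y = P u\<close>, so a second application
  of the Rota--Baxter identity gives \<open>(P x \<diamond> P y) \<diamond> P z = P (P u \<diamond> z + u \<diamond> P z + \<lambda> (u \<diamond> z))\<close>. Leaving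
  \<open>P u\<close> folded as \<open>P x \<diamond> P y\<close> in the first summand makes the right-hand side a sum of seven triple
  products, one for each way of removing \<open>P\<close> from at least one of the factors. The other bracketing
  is treated symmetrically.\<close>

lemma associator_of_grafts:
  fixes lam :: "'k::{comm_ring, comm_monoid_mult}"
  defines "D \<equiv> diamond lam" and "P \<equiv> graft_lin :: (pforest \<Rightarrow>\<^sub>0 'k) \<Rightarrow> (pforest \<Rightarrow>\<^sub>0 'k)"
  assumes a: "D (D (P x) (P y)) z = D (P x) (D (P y) z)"
      "D (D (P x) y) (P z) = D (P x) (D y (P z))"
      "D (D x (P y)) (P z) = D x (D (P y) (P z))"
      "D (D x y) (P z) = D x (D y (P z))"
      "D (D x (P y)) z = D x (D (P y) z)"
      "D (D (P x) y) z = D (P x) (D y z)"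
      "D (D x y) z = D x (D y z)"
  shows "D (D (P x) (P y)) (P z) = D (P x) (D (P y) (P z))"
proof -
  define u where "u = D (P x) y + D x (P y) + fscale lam (D x y)"
  define v where "v = D (P y) z + D y (P z) + fscale lam (D y z)"
  have u: "D (P x) (P y) = P u" and v: "D (P y) (P z) = P v"
    unfolding u_def v_def D_def P_def by (rule diamond_graft_graft)+
  note bil = diamond_bilinear[of lam, folded D_def]
  have "D (P u) (P z) = P (D (D (P x) (P y)) z + D u (P z) + fscale lam (D u z))"
    unfolding u unfolding D_def P_def by (rule diamond_graft_graft)
  also have "D (D (P x) (P y)) z + D u (P z) + fscale lam (D u z)
      = D (P x) v + D x (D (P y) (P z)) + fscale lam (D x v)"
    unfolding u_def v_def by (simp add: bil fscale_add_right a ac_simps)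
  also have "P \<dots> = D (P x) (P v)"
    unfolding v unfolding D_def P_def by (rule diamond_graft_graft[symmetric])
  finally show ?thesis by (simp add: u v)
qed

lemma diamond_assoc_basis:
  "diamond lam (diamond lam (basis F) (basis G)) (basis H)
    = diamond lam (basis F) (diamond lam (basis G) (basis H))"
proof (induction "size F + size G + size H" arbitrary: F G H rule: less_induct)
  case less
  note IH = less
  have FCons: "basis (FCons t E) = concat_lin (basis (FSingle t)) (basis E)" for t E
    by (simp add: concat_lin_basis)
  show ?case
  proof (cases F)
    case F: (FCons t F')
    have "diamond lam (diamond lam (basis F') (basis G)) (basis H)
        = diamond lam (basis F') (diamond lam (basis G) (basis H))"
      by (rule IH) (simp add: F)
    then show ?thesis by (simp add: F FCons diamond_concat_left)
  next
    case F: (FSingle r)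
    show ?thesis
    proof (cases G)
      case G: (FCons t G')
      show ?thesis by (simp add: G FCons diamond_concat_left diamond_concat_right)
    next
      case G: (FSingle s)
      show ?thesis
      proof (cases H)
        case H: (FCons t H')
        have "diamond lam (diamond lam (basis F) (basis G)) (basis (FSingle t))
            = diamond lam (basis F) (diamond lam (basis G) (basis (FSingle t)))"
          by (rule IH) (cases H', simp_all add: H)
        then show ?thesis by (simp add: H FCons diamond_concat_right)
      next
        case H: (FSingle t)
        show ?thesis
        proof (cases "r = Bullet \<or> s = Bullet \<or> t = Bullet")
          case True
          then show ?thesis by (auto simp: F G H diamond_unit_left diamond_unit_right)
        next
          case False
          then obtain F' G' H' where trees: "r = Graft F'" "s = Graft G'" "t = Graft H'"
            by (metis ptree.exhaust)
          show ?thesis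
            unfolding F G H trees graft_lin_basis[symmetric]
            by (intro associator_of_grafts)
              (unfold graft_lin_basis, (rule IH, simp add: F G H trees)+)
        qed
      qed
    qed
  qed
qed

lemma diamond_assoc:
  "diamond lam (diamond lam x y) z = diamond lam x (diamond lam y z)"
proof (induction x rule: free_module_induct)
  case (basis F)
  show ?case
  proof (induction y rule: free_module_induct)
    case (basis G)
    show ?case
      by (induction z rule: free_module_induct)
        (simp_all add: diamond_assoc_basis diamond_bilinear)
  qed (simp_all add: diamond_bilinear)
qed (simp_all add: diamond_bilinear)

theorem theorem2p3:
  fixes lam :: "'k::{comm_ring, comm_monoid_mult}"
  shows "unitary_associative_algebra fscale (diamond lam)
    \<and> unitary_rota_baxter_algebra fscale (diamond lam) lam graft_lin"
proof -
  have alg: "unitary_associative_algebra fscale (diamond lam)"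
  proof
    show "\<exists>e. \<forall>x. diamond lam e x = x \<and> diamond lam x e = x"
      using diamond_unit_left diamond_unit_right by blast
  qed (simp_all add: fscale_add_right fscale_add_left fscale_fscale fscale_one
      diamond_bilinear diamond_assoc)
  then interpret unitary_associative_algebra fscale "diamond lam" .
  have "unitary_rota_baxter_algebra fscale (diamond lam) lam graft_lin"
    by unfold_locales (simp_all only: graft_lin_linear diamond_graft_graft)
  with alg show ?thesis by blast
qed

end
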